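(* Let $G:C\to D$ be a functor between $\Omega$-spaces, with canonical extensions $C^\delta$ (with respect to $F_C\subseteq\mathcal UC$, $I_C\subseteq\mathcal DC$) and $D^\delta$ (with respect to $F_D\subseteq\mathcal UD$, $I_D\subseteq\mathcal DD$). (1) If $G_l(f)\in F_C$ and $G_\pi(i)\in I_D$ for every $i\in I_C$ and $f\in F_D$, then $G^l\dashv G^\pi$, i.e. $C^\delta(G^l(\kappa),\lambda)=D^\delta(\kappa,G^\pi(\lambda))$ for all $\kappa\in D^\delta$, $\lambda\in C^\delta$. (2) If $G_\sigma(f)\in F_D$ and $G_r(i)\in I_C$ for every $i\in I_D$ and $f\in F_C$, then $G^\sigma\dashv G^r$, i.e. $D^\delta(G^\sigma(\kappa),\lambda)=C^\delta(\kappa,G^r(\lambda))$ for all $\kappa\in C^\delta$, $\lambda\in D^\delta$.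
   Context: Quantale: $\Omega=(\Omega,\sqsubseteq,\bigsqcup,e,\cdot)$ is a complete lattice (joins $\bigsqcup$, meets $\bigwedge$) with a monoid structure $(e,\cdot)$, not necessarily commutative, whose multiplication preserves arbitrary joins in each argument. Residuals $\rhd,\lhd$ are defined by $b\sqsubseteq a\rhd c\Leftrightarrow a\cdot b\sqsubseteq c\Leftrightarrow a\sqsubseteq c\lhd b$. $\Omega$-space: a set $X$ with $X(-,-):X\times X\to\Omega$ such that $e\sqsubseteq X(x,x)$ and $X(x,y)\cdot X(y,z)\sqsubseteq X(x,z)$. A functor $G:X\to Y$ is a map with $X(x,x')\sqsubseteq Y(Gx,Gx')$. $\mathcal DX$ (weighted downsets, presheaves): functions $\phi:X\to\Omega$ with $X(x',x)\cdot\phi(x)\sqsubseteq\phi(x')$; an $\Omega$-space with hom $\mathcal DX(\phi,\phi')=\bigwedge_x\phi(x)\rhd\phi'(x)$. $\mathcal UX$ (weighted upsets, co-presheaves): functions $\psi:X\to\Omega$ with $\psi(x)\cdot X(x,x')\sqsubseteq\psi(x')$; an $\Omega$-space with hom $\mathcal UX(\psi,\psi')=\bigwedge_x\psi(x)\lhd\psi'(x)$. Weighted (co)limits: for a functor $H:X\to B$, the colimit of $H$ weighted by $\phi\in\mathcal DX$ is an element $\mathrm{colim}_\phi H\in B$ with $B(\mathrm{colim}_\phi H,b)=\bigwedge_{x}\phi(x)\rhd B(Hx,b)$ for all $b$; the limit weighted by $\psi\in\mathcal UX$ is an element $\lim_\psi H\in B$ with $B(b,\lim_\psi H)=\bigwedge_x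 B(b,Hx)\lhd\psi(x)$ for all $b$. When $X$ is a mere set (such as $F$, $I$ below) it is regarded as a discrete space, so weights are arbitrary functions $X\to\Omega$ and $H$ is any function. Canonical extension: let $F=F_C\subseteq\mathcal UC$ and $I=I_C\subseteq\mathcal DC$ be subsets which (standing assumption) contain all representables, i.e. $C(c,-)\in F$ and $C(-,c)\in I$. Put $\mathbf I(f,i)=\bigsqcup_{c}f(c)\cdot i(c)$. The elements of $C^\delta$ are pairs $\kappa=(\phi_\kappa,\psi_\kappa)$ of functions $\phi_\kappa:F\to\Omega$, $\psi_\kappa:I\to\Omega$ with $\psi_\kappa(i)=\bigwedge_{f\in F}\phi_\kappa(f)\rhd\mathbf I(f,i)$ and $\phi_\kappa(f)=\bigwedge_{i\in I}\mathbf I(f,i)\lhd\psi_\kappa(i)$. The hom is $C^\delta(\kappa,\kappa')=\bigwedge_{f}\phi_\kappa(f)\rhd\phi_{\kappa'}(f)=\bigwedge_i\psi_\kappa(i)\lhd\psi_{\kappa'}(i)$ (the two agree). $C^\delta$ has all weighted limits and colimits, and they are unique. For $f\in F$, $\overline f\in C^\delta$ is the element with $\psi_{\overline f}=\mathbf I(f,-)$; for $i\in I$, $\overline i\in C^\delta$ is the element with $\phi_{\overline i}=\mathbf I(-,i)$. Likewise for $D$. Operations induced by $G:C\to D$: - $G_l:\mathcal UD\to\mathcal UC$, $G_l(f)(c)=f(Gc)$; $G_r:\mathcal DD\to\mathcal DC$, $G_r(i)(c)=i(Gc)$. - $G_\pi:\mathcal DC\to\mathcal DD$, $G_\pi(i)=\mathrm{colim}_i\,D(-,G)$,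 the colimit in $\mathcal DD$ of $c\mapsto D(-,Gc)$ weighted by $i$ (explicitly $G_\pi(i)(d)=\bigsqcup_c D(d,Gc)\cdot i(c)$); $G_\sigma:\mathcal UC\to\mathcal UD$, $G_\sigma(f)=\lim_f D(G,-)$, the limit in $\mathcal UD$ of $c\mapsto D(Gc,-)$ weighted by $f$ (explicitly $G_\sigma(f)(d)=\bigsqcup_c f(c)\cdot D(Gc,d)$). - $G^l,G^r:D^\delta\to C^\delta$: $G^l(\kappa)$ is the colimit in $C^\delta$ of $F_D\ni f\mapsto\overline{G_l(f)}$ weighted by $\phi_\kappa$; $G^r(\kappa)$ is the limit in $C^\delta$ of $I_D\ni i\mapsto\overline{G_r(i)}$ weighted by $\psi_\kappa$. - $G^\pi,G^\sigma:C^\delta\to D^\delta$: $G^\pi(\kappa)$ is the limit in $D^\delta$ of $I_C\ni i\mapsto\overline{G_\pi(i)}$ weighted by $\psi_\kappa$; $G^\sigma(\kappa)$ is the colimit in $D^\delta$ of $F_C\ni f\mapsto\overline{G_\sigma(f)}$ weighted by $\phi_\kappa$. *)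

theory Defs
  imports Main "HOL-Library.FuncSet"
begin

class quantale = complete_lattice + monoid_mult +
  assumes mult_Sup_distrib: "a * Sup B = (SUP b\<in>B. a * b)"
    and Sup_mult_distrib: "Sup A * b = (SUP a\<in>A. a * b)"
begin

definition rres :: "'a \<Rightarrow> 'a \<Rightarrow> 'a"  (infix "\<rhd>" 65)
  where "a \<rhd> c = Sup {b. a * b \<le> c}"

definition lres :: "'a \<Rightarrow> 'a \<Rightarrow> 'a"  (infix "\<lhd>" 65)
  where "c \<lhd> b = Sup {a. a * b \<le> c}"

lemma mult_left_mono_q: "b \<le> b' \<Longrightarrow> a * b \<le> a * b'"
proof -
  assume "b \<le> b'"
  then have "Sup {b, b'} = b'" by (simp add: sup_absorb2)
  then have "a * b' = (SUP x\<in>{b, b'}. a * x)" by (metis mult_Sup_distrib)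
  also have "\<dots> = sup (a * b) (a * b')" by simp
  finally show ?thesis by (metis sup_ge1)
qed

lemma mult_right_mono_q: "a \<le> a' \<Longrightarrow> a * b \<le> a' * b"
proof -
  assume "a \<le> a'"
  then have "Sup {a, a'} = a'" by (simp add: sup_absorb2)
  then have "a' * b = (SUP x\<in>{a, a'}. x * b)" by (metis Sup_mult_distrib)
  also have "\<dots> = sup (a * b) (a' * b)" by simp
  finally show ?thesis by (metis sup_ge1)
qed

lemma rres_iff: "b \<le> a \<rhd> c \<longleftrightarrow> a * b \<le> c"
proof
  assume "b \<le> a \<rhd> c"
  then have "a * b \<le> a * (a \<rhd> c)" by (rule mult_left_mono_q)
  also have "\<dots> \<le> c" unfolding rres_def mult_Sup_distrib by (auto intro: SUP_least)
  finally show "a * b \<le> c" .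
qed (auto simp: rres_def intro: Sup_upper)

lemma lres_iff: "a \<le> c \<lhd> b \<longleftrightarrow> a * b \<le> c"
proof
  assume "a \<le> c \<lhd> b"
  then have "a * b \<le> (c \<lhd> b) * b" by (rule mult_right_mono_q)
  also have "\<dots> \<le> c" unfolding lres_def Sup_mult_distrib by (auto intro: SUP_least)
  finally show "a * b \<le> c" .
qed (auto simp: lres_def intro: Sup_upper)

end

text \<open>
  A space has a carrier set (possibly empty) inside a type. Functions out of a carrier are
  extensional (\<^term>\<open>X \<rightarrow>\<^sub>E UNIV\<close>), so that equality in the set-level function spaces is
  equality on the carrier.
\<close>

record ('a, 'q) space =
  pts :: "'a set"
  hom :: "'a \<Rightarrow> 'a \<Rightarrow> 'q"

definition is_space :: "('a, 'q::quantale) space \<Rightarrow> bool" where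
  "is_space X \<longleftrightarrow>
     (\<forall>x\<in>pts X. 1 \<le> hom X x x) \<and>
     (\<forall>x\<in>pts X. \<forall>y\<in>pts X. \<forall>z\<in>pts X. hom X x y * hom X y z \<le> hom X x z)"

definition is_functor :: "('a, 'q::quantale) space \<Rightarrow> ('b, 'q) space \<Rightarrow> ('a \<Rightarrow> 'b) \<Rightarrow> bool" where
  "is_functor X Y G \<longleftrightarrow>
     G \<in> pts X \<rightarrow> pts Y \<and> (\<forall>x\<in>pts X. \<forall>x'\<in>pts X. hom X x x' \<le> hom Y (G x) (G x'))"

definition discrete :: "'a set \<Rightarrow> ('a, 'q::quantale) space" where
  "discrete S = \<lparr>pts = S, hom = (\<lambda>x y. if x = y then 1 else bot)\<rparr>"

definition downsets :: "('a, 'q::quantale) space \<Rightarrow> ('a \<Rightarrow> 'q, 'q) space"  ("\<D>") where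
  "\<D> X = \<lparr>pts = {\<phi> \<in> pts X \<rightarrow>\<^sub>E UNIV. \<forall>x\<in>pts X. \<forall>x'\<in>pts X. hom X x' x * \<phi> x \<le> \<phi> x'},
          hom = (\<lambda>\<phi> \<phi>'. INF x\<in>pts X. \<phi> x \<rhd> \<phi>' x)\<rparr>"

definition upsets :: "('a, 'q::quantale) space \<Rightarrow> ('a \<Rightarrow> 'q, 'q) space"  ("\<U>") where
  "\<U> X = \<lparr>pts = {\<psi> \<in> pts X \<rightarrow>\<^sub>E UNIV. \<forall>x\<in>pts X. \<forall>x'\<in>pts X. \<psi> x * hom X x x' \<le> \<psi> x'},
          hom = (\<lambda>\<psi> \<psi>'. INF x\<in>pts X. \<psi> x \<lhd> \<psi>' x)\<rparr>"

definition down_rep :: "('a, 'q::quantale) space \<Rightarrow> 'a \<Rightarrow> ('a \<Rightarrow> 'q)" where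
  "down_rep X y = (\<lambda>x\<in>pts X. hom X x y)"

definition up_rep :: "('a, 'q::quantale) space \<Rightarrow> 'a \<Rightarrow> ('a \<Rightarrow> 'q)" where
  "up_rep X x = (\<lambda>y\<in>pts X. hom X x y)"

text \<open>
  In the next four definitions \<^term>\<open>H\<close> is meant to be a functor \<^term>\<open>X\<close> to \<^term>\<open>B\<close>; the
  weight is meant to lie in \<^term>\<open>pts (\<D> X)\<close> for colimits, in \<^term>\<open>pts (\<U> X)\<close> for limits.
\<close>

definition is_colim ::
  "('b, 'q::quantale) space \<Rightarrow> ('a, 'q) space \<Rightarrow> ('a \<Rightarrow> 'q) \<Rightarrow> ('a \<Rightarrow> 'b) \<Rightarrow> 'b \<Rightarrow> bool" where
  "is_colim B X \<phi> H k \<longleftrightarrow>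
     k \<in> pts B \<and> (\<forall>b\<in>pts B. hom B k b = (INF x\<in>pts X. \<phi> x \<rhd> hom B (H x) b))"

definition is_lim ::
  "('b, 'q::quantale) space \<Rightarrow> ('a, 'q) space \<Rightarrow> ('a \<Rightarrow> 'q) \<Rightarrow> ('a \<Rightarrow> 'b) \<Rightarrow> 'b \<Rightarrow> bool" where
  "is_lim B X \<psi> H k \<longleftrightarrow>
     k \<in> pts B \<and> (\<forall>b\<in>pts B. hom B b k = (INF x\<in>pts X. hom B b (H x) \<lhd> \<psi> x))"

definition wcolim ::
  "('b, 'q::quantale) space \<Rightarrow> ('a, 'q) space \<Rightarrow> ('a \<Rightarrow> 'q) \<Rightarrow> ('a \<Rightarrow> 'b) \<Rightarrow> 'b" where
  "wcolim B X \<phi> H = (THE k. is_colim B X \<phi> H k)"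

definition wlim ::
  "('b, 'q::quantale) space \<Rightarrow> ('a, 'q) space \<Rightarrow> ('a \<Rightarrow> 'q) \<Rightarrow> ('a \<Rightarrow> 'b) \<Rightarrow> 'b" where
  "wlim B X \<psi> H = (THE k. is_lim B X \<psi> H k)"

definition ext_data ::
  "('a, 'q::quantale) space \<Rightarrow> ('a \<Rightarrow> 'q) set \<Rightarrow> ('a \<Rightarrow> 'q) set \<Rightarrow> bool" where
  "ext_data C F I \<longleftrightarrow>
     F \<subseteq> pts (\<U> C) \<and> I \<subseteq> pts (\<D> C) \<and>
     (\<forall>c\<in>pts C. up_rep C c \<in> F) \<and> (\<forall>c\<in>pts C. down_rep C c \<in> I)"

definition pairing :: "('a, 'q::quantale) space \<Rightarrow> ('a \<Rightarrow> 'q) \<Rightarrow> ('a \<Rightarrow> 'q) \<Rightarrow> 'q" where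
  "pairing C f i = (SUP c\<in>pts C. f c * i c)"

type_synonym ('a, 'q) cut = "(('a \<Rightarrow> 'q) \<Rightarrow> 'q) \<times> (('a \<Rightarrow> 'q) \<Rightarrow> 'q)"

definition canext ::
  "('a, 'q::quantale) space \<Rightarrow> ('a \<Rightarrow> 'q) set \<Rightarrow> ('a \<Rightarrow> 'q) set \<Rightarrow> (('a, 'q) cut, 'q) space" where
  "canext C F I =
     \<lparr>pts = {(\<phi>, \<psi>). \<phi> \<in> F \<rightarrow>\<^sub>E UNIV \<and> \<psi> \<in> I \<rightarrow>\<^sub>E UNIV \<and>
               (\<forall>i\<in>I. \<psi> i = (INF f\<in>F. \<phi> f \<rhd> pairing C f i)) \<and>
               (\<forall>f\<in>F. \<phi> f = (INF i\<in>I. pairing C f i \<lhd> \<psi> i))},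
      hom = (\<lambda>\<kappa> \<kappa>'. INF f\<in>F. fst \<kappa> f \<rhd> fst \<kappa>' f)\<rparr>"

lemma canext_hom_snd:
  assumes "\<kappa> \<in> pts (canext C F I)" "\<kappa>' \<in> pts (canext C F I)"
  shows "hom (canext C F I) \<kappa> \<kappa>' = (INF i\<in>I. snd \<kappa> i \<lhd> snd \<kappa>' i)"
proof -
  obtain \<phi> \<psi> \<phi>' \<psi>' where k: "\<kappa> = (\<phi>, \<psi>)" "\<kappa>' = (\<phi>', \<psi>')"
    by (metis surj_pair)
  have 1: "\<forall>i\<in>I. \<psi> i = (INF f\<in>F. \<phi> f \<rhd> pairing C f i)"
    and 2: "\<forall>f\<in>F. \<phi>' f = (INF i\<in>I. pairing C f i \<lhd> \<psi>' i)"
    using assms by (auto simp: k canext_def)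
  have "x \<le> (INF f\<in>F. \<phi> f \<rhd> \<phi>' f) \<longleftrightarrow> x \<le> (INF i\<in>I. \<psi> i \<lhd> \<psi>' i)" for x
    using 1 2 by (auto simp: le_INF_iff rres_iff lres_iff mult.assoc)
  then show ?thesis by (simp add: k canext_def) (meson order.eq_iff order.refl)
qed

definition bar_up ::
  "('a, 'q::quantale) space \<Rightarrow> ('a \<Rightarrow> 'q) set \<Rightarrow> ('a \<Rightarrow> 'q) set \<Rightarrow> ('a \<Rightarrow> 'q) \<Rightarrow> ('a, 'q) cut" where
  "bar_up C F I f = (THE \<kappa>. \<kappa> \<in> pts (canext C F I) \<and> (\<forall>i\<in>I. snd \<kappa> i = pairing C f i))"

definition bar_down ::
  "('a, 'q::quantale) space \<Rightarrow> ('a \<Rightarrow> 'q) set \<Rightarrow> ('a \<Rightarrow> 'q) set \<Rightarrow> ('a \<Rightarrow> 'q) \<Rightarrow> ('a, 'q) cut" where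
  "bar_down C F I i = (THE \<kappa>. \<kappa> \<in> pts (canext C F I) \<and> (\<forall>f\<in>F. fst \<kappa> f = pairing C f i))"

text \<open>
  For \<open>G : C \<rightarrow> D\<close>: \<open>pull C G\<close> is precomposition with \<open>G\<close>; it is \<open>G\<^sub>l\<close> on \<open>\<U> D\<close> and \<open>G\<^sub>r\<close> on
  \<open>\<D> D\<close>. Then \<open>push_down\<close> is \<open>G\<^sub>\<pi>\<close> and \<open>push_up\<close> is \<open>G\<^sub>\<sigma>\<close>.
\<close>

definition pull :: "('a, 'q::quantale) space \<Rightarrow> ('a \<Rightarrow> 'b) \<Rightarrow> ('b \<Rightarrow> 'q) \<Rightarrow> ('a \<Rightarrow> 'q)" where
  "pull C G f = (\<lambda>c\<in>pts C. f (G c))"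

definition push_down ::
  "('a, 'q::quantale) space \<Rightarrow> ('b, 'q) space \<Rightarrow> ('a \<Rightarrow> 'b) \<Rightarrow> ('a \<Rightarrow> 'q) \<Rightarrow> ('b \<Rightarrow> 'q)" where
  "push_down C D G i = wcolim (\<D> D) C i (\<lambda>c. down_rep D (G c))"

definition push_up ::
  "('a, 'q::quantale) space \<Rightarrow> ('b, 'q) space \<Rightarrow> ('a \<Rightarrow> 'b) \<Rightarrow> ('a \<Rightarrow> 'q) \<Rightarrow> ('b \<Rightarrow> 'q)" where
  "push_up C D G f = wlim (\<U> D) C f (\<lambda>c. up_rep D (G c))"

text \<open>
  The superscripted \<open>G\<^sup>l, G\<^sup>r : D\<^sup>\<delta> \<rightarrow> C\<^sup>\<delta>\<close> and \<open>G\<^sup>\<pi>, G\<^sup>\<sigma> : C\<^sup>\<delta> \<rightarrow> D\<^sup>\<delta>\<close>.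
\<close>

definition ext_l ::
  "('a, 'q::quantale) space \<Rightarrow> ('a \<Rightarrow> 'q) set \<Rightarrow> ('a \<Rightarrow> 'q) set \<Rightarrow> ('b \<Rightarrow> 'q) set \<Rightarrow>
   ('a \<Rightarrow> 'b) \<Rightarrow> ('b, 'q) cut \<Rightarrow> ('a, 'q) cut" where
  "ext_l C FC IC FD G \<kappa> =
     wcolim (canext C FC IC) (discrete FD) (fst \<kappa>) (\<lambda>f. bar_up C FC IC (pull C G f))"

definition ext_r ::
  "('a, 'q::quantale) space \<Rightarrow> ('a \<Rightarrow> 'q) set \<Rightarrow> ('a \<Rightarrow> 'q) set \<Rightarrow> ('b \<Rightarrow> 'q) set \<Rightarrow>
   ('a \<Rightarrow> 'b) \<Rightarrow> ('b, 'q) cut \<Rightarrow> ('a, 'q) cut" where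
  "ext_r C FC IC ID G \<kappa> =
     wlim (canext C FC IC) (discrete ID) (snd \<kappa>) (\<lambda>i. bar_down C FC IC (pull C G i))"

definition ext_pi ::
  "('a, 'q::quantale) space \<Rightarrow> ('a \<Rightarrow> 'q) set \<Rightarrow>
   ('b, 'q) space \<Rightarrow> ('b \<Rightarrow> 'q) set \<Rightarrow> ('b \<Rightarrow> 'q) set \<Rightarrow>
   ('a \<Rightarrow> 'b) \<Rightarrow> ('a, 'q) cut \<Rightarrow> ('b, 'q) cut" where
  "ext_pi C IC D FD ID G \<kappa> =
     wlim (canext D FD ID) (discrete IC) (snd \<kappa>) (\<lambda>i. bar_down D FD ID (push_down C D G i))"

definition ext_sigma ::
  "('a, 'q::quantale) space \<Rightarrow> ('a \<Rightarrow> 'q) set \<Rightarrow>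
   ('b, 'q) space \<Rightarrow> ('b \<Rightarrow> 'q) set \<Rightarrow> ('b \<Rightarrow> 'q) set \<Rightarrow>
   ('a \<Rightarrow> 'b) \<Rightarrow> ('a, 'q) cut \<Rightarrow> ('b, 'q) cut" where
  "ext_sigma C FC D FD ID G \<kappa> =
     wcolim (canext D FD ID) (discrete FC) (fst \<kappa>) (\<lambda>f. bar_up D FD ID (push_up C D G f))"

text \<open>
  Functoriality of both maps follows from the hom equation (\<open>adjunction_functors\<close> below).
\<close>

definition adjunction ::
  "('a, 'q::quantale) space \<Rightarrow> ('b, 'q) space \<Rightarrow> ('a \<Rightarrow> 'b) \<Rightarrow> ('b \<Rightarrow> 'a) \<Rightarrow> bool" where
  "adjunction X Y L R \<longleftrightarrow>
     L \<in> pts X \<rightarrow> pts Y \<and> R \<in> pts Y \<rightarrow> pts X \<and>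
     (\<forall>x\<in>pts X. \<forall>y\<in>pts Y. hom Y (L x) y = hom X x (R y))"

lemma adjunction_functors:
  assumes X: "is_space X" and Y: "is_space Y" and adj: "adjunction X Y L R"
  shows "is_functor X Y L" "is_functor Y X R"
proof -
  have L: "L x \<in> pts Y" if "x \<in> pts X" for x using adj that by (auto simp: adjunction_def)
  have R: "R y \<in> pts X" if "y \<in> pts Y" for y using adj that by (auto simp: adjunction_def)
  have E: "hom Y (L x) y = hom X x (R y)" if "x \<in> pts X" "y \<in> pts Y" for x y
    using adj that by (auto simp: adjunction_def)
  have "hom X x x' \<le> hom Y (L x) (L x')" if x: "x \<in> pts X" "x' \<in> pts X" for x x'
  proof -
    have "1 \<le> hom X x' (R (L x'))"
      using Y E L x by (metis is_space_def)
    then have "hom X x x' * 1 \<le> hom X x x' * hom X x' (R (L x'))" by (rule mult_left_mono_q)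
    also have "\<dots> \<le> hom X x (R (L x'))" using X x L R unfolding is_space_def by blast
    finally show ?thesis using E L x by simp
  qed
  then show "is_functor X Y L" using L by (auto simp: is_functor_def)
  have "hom Y y y' \<le> hom X (R y) (R y')" if y: "y \<in> pts Y" "y' \<in> pts Y" for y y'
  proof -
    have "1 \<le> hom Y (L (R y)) y"
      using X E R y by (metis is_space_def)
    then have "1 * hom Y y y' \<le> hom Y (L (R y)) y * hom Y y y'" by (rule mult_right_mono_q)
    also have "\<dots> \<le> hom Y (L (R y)) y'" using Y y L R unfolding is_space_def by blast
    finally show ?thesis using E R y by simp
  qed
  then show "is_functor Y X R" using R by (auto simp: is_functor_def)
qed

end

theory Submission
  imports Defs
begin

text \<open>
  Both adjunctions are instances of one fact about polarities. Regard \<open>(F, I, pairing)\<close> as an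
  \<open>\<Omega>\<close>-valued relation between the sets \<open>F\<close> and \<open>I\<close>; the canonical extension is its space of cuts.
  Suppose that \<open>P : F\<^sub>A \<rightarrow> F\<^sub>B\<close> and \<open>Q : I\<^sub>B \<rightarrow> I\<^sub>A\<close> are adjoint for the two pairings:
  the pairing of \<open>P f\<close> with \<open>i\<close> over \<open>B\<close> is the pairing of \<open>f\<close> with \<open>Q i\<close> over \<open>A\<close>. Maps out of
  \<open>bar_up g\<close> evaluate the first component of a cut at \<open>g\<close>, and maps into \<open>bar_down j\<close> evaluate
  the second component at \<open>j\<close> (\<open>bar_up_hom\<close>, \<open>hom_bar_down\<close>). So, for cuts \<open>(\<phi>, \<psi>)\<close> over \<open>A\<close> and
  \<open>(\<phi>', \<psi>')\<close> over \<open>B\<close>, a hom out of the colimit of the \<open>bar_up (P f)\<close> weighted by \<open>\<phi>\<close>, and a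
  hom into the limit of the \<open>bar_down (Q i)\<close> weighted by \<open>\<psi>'\<close>, are bounded below by \<open>x\<close> exactly when

    \<open>\<phi> f * x * \<psi>' i \<le> pairing (P f) i\<close>, respectively \<open>\<phi> f * x * \<psi>' i \<le> pairing f (Q i)\<close>,

  for all \<open>f\<close> and \<open>i\<close>; these conditions are the same. This is \<open>polarity_adjunction\<close>.

  What is specific to a map \<open>G\<close> is that precomposition with \<open>G\<close> is adjoint to the pushforwards
  \<open>G\<^sub>\<pi>\<close> and \<open>G\<^sub>\<sigma>\<close> for the pairings, which is the co-Yoneda identity for \<open>D\<close>
  (\<open>pairing_push_down\<close>, \<open>pairing_push_up\<close>). The roles of \<open>P\<close> and \<open>Q\<close> are played by \<open>G\<^sub>l\<close> and
  \<open>G\<^sub>\<pi>\<close> in the first adjunction, by \<open>G\<^sub>\<sigma>\<close> and \<open>G\<^sub>r\<close> in the second.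
\<close>

section \<open>Joins in a quantale\<close>

lemma eq_if_same_lower_bounds:
  fixes a b :: "'q::order"
  assumes "\<And>x. x \<le> a \<longleftrightarrow> x \<le> b"
  shows "a = b"
  using assms by (meson order.antisym order.refl)

lemma mult_SUP:
  fixes a :: "'q::quantale"
  shows "a * (SUP s\<in>S. g s) = (SUP s\<in>S. a * g s)"
  by (simp add: mult_Sup_distrib image_image)

lemma SUP_mult:
  fixes a :: "'q::quantale"
  shows "(SUP s\<in>S. g s) * a = (SUP s\<in>S. g s * a)"
  by (simp add: Sup_mult_distrib image_image)

section \<open>Uniqueness of weighted limits and colimits\<close>

text \<open>
  Antisymmetry of the underlying order makes representing objects unique, so that the definite
  descriptions in \<open>wcolim\<close> and \<open>wlim\<close> denote as soon as a universal object exists.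
\<close>

definition separated :: "('b, 'q::quantale) space \<Rightarrow> bool" where
  "separated B \<longleftrightarrow>
     (\<forall>x\<in>pts B. 1 \<le> hom B x x) \<and>
     (\<forall>x\<in>pts B. \<forall>y\<in>pts B. 1 \<le> hom B x y \<longrightarrow> 1 \<le> hom B y x \<longrightarrow> x = y)"

lemma wcolim_eq:
  assumes "separated B" "is_colim B X \<phi> H k"
  shows "wcolim B X \<phi> H = k"
  unfolding wcolim_def
proof (rule the_equality)
  show "k' = k" if "is_colim B X \<phi> H k'" for k'
  proof -
    have pts: "k \<in> pts B" "k' \<in> pts B" using assms(2) that by (simp_all add: is_colim_def)
    have homs: "hom B k b = hom B k' b" if "b \<in> pts B" for b
      using assms(2) \<open>is_colim B X \<phi> H k'\<close> that by (simp add: is_colim_def)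
    have "1 \<le> hom B k k'" "1 \<le> hom B k' k"
      using assms(1) pts homs[OF pts(1), symmetric] homs[OF pts(2)] by (simp_all add: separated_def)
    then show ?thesis using assms(1) pts by (simp add: separated_def)
  qed
qed (rule assms(2))

lemma wlim_eq:
  assumes "separated B" "is_lim B X \<psi> H k"
  shows "wlim B X \<psi> H = k"
  unfolding wlim_def
proof (rule the_equality)
  show "k' = k" if "is_lim B X \<psi> H k'" for k'
  proof -
    have pts: "k \<in> pts B" "k' \<in> pts B" using assms(2) that by (simp_all add: is_lim_def)
    have homs: "hom B b k = hom B b k'" if "b \<in> pts B" for b
      using assms(2) \<open>is_lim B X \<psi> H k'\<close> that by (simp add: is_lim_def)
    have "1 \<le> hom B k k'" "1 \<le> hom B k' k"
      using assms(1) pts homs[OF pts(1), symmetric] homs[OF pts(2)] by (simp_all add: separated_def)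
    then show ?thesis using assms(1) pts by (simp add: separated_def)
  qed
qed (rule assms(2))

lemma le_downsets_hom:
  "x \<le> hom (\<D> X) \<phi> \<phi>' \<longleftrightarrow> (\<forall>a\<in>pts X. \<phi> a * x \<le> \<phi>' a)"
  by (simp add: downsets_def le_INF_iff rres_iff)

lemma le_upsets_hom:
  "x \<le> hom (\<U> X) \<psi> \<psi>' \<longleftrightarrow> (\<forall>a\<in>pts X. x * \<psi>' a \<le> \<psi> a)"
  by (simp add: upsets_def le_INF_iff lres_iff)

lemma separated_downsets: "separated (\<D> X)"
proof -
  have "x = y" if "x \<in> pts (\<D> X)" "y \<in> pts (\<D> X)"
    and "\<And>a. a \<in> pts X \<Longrightarrow> x a \<le> y a" "\<And>a. a \<in> pts X \<Longrightarrow> y a \<le> x a" for x y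
  proof (rule PiE_ext[of _ "pts X" "\<lambda>_. UNIV"])
    show "x a = y a" if "a \<in> pts X" for a
      using \<open>\<And>a. a \<in> pts X \<Longrightarrow> x a \<le> y a\<close> \<open>\<And>a. a \<in> pts X \<Longrightarrow> y a \<le> x a\<close> that
      by (blast intro: order.antisym)
  qed (use that(1,2) in \<open>simp_all add: downsets_def\<close>)
  then show ?thesis
    unfolding separated_def le_downsets_hom by simp
qed

lemma separated_upsets: "separated (\<U> X)"
proof -
  have "x = y" if "x \<in> pts (\<U> X)" "y \<in> pts (\<U> X)"
    and "\<And>a. a \<in> pts X \<Longrightarrow> x a \<le> y a" "\<And>a. a \<in> pts X \<Longrightarrow> y a \<le> x a" for x y
  proof (rule PiE_ext[of _ "pts X" "\<lambda>_. UNIV"])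
    show "x a = y a" if "a \<in> pts X" for a
      using \<open>\<And>a. a \<in> pts X \<Longrightarrow> x a \<le> y a\<close> \<open>\<And>a. a \<in> pts X \<Longrightarrow> y a \<le> x a\<close> that
      by (blast intro: order.antisym)
  qed (use that(1,2) in \<open>simp_all add: upsets_def\<close>)
  then show ?thesis
    unfolding separated_def le_upsets_hom by simp
qed

section \<open>The space of cuts\<close>

text \<open>
  The equations for the two components of a cut rewrite into each other without end. Each is used
  on its own, in the form of the lower-bound criteria \<open>le_fst_cut\<close> and \<open>le_snd_cut\<close>.
\<close>

lemma cut_components:
  assumes "\<kappa> \<in> pts (canext C F I)"
  shows "fst \<kappa> \<in> F \<rightarrow>\<^sub>E UNIV" "snd \<kappa> \<in> I \<rightarrow>\<^sub>E UNIV"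
    and "\<And>i. i \<in> I \<Longrightarrow> snd \<kappa> i = (INF f\<in>F. fst \<kappa> f \<rhd> pairing C f i)"
    and "\<And>f. f \<in> F \<Longrightarrow> fst \<kappa> f = (INF i\<in>I. pairing C f i \<lhd> snd \<kappa> i)"
  using assms unfolding canext_def space.simps mem_Collect_eq split_beta by blast+

lemma cutI:
  assumes "\<phi> \<in> F \<rightarrow>\<^sub>E UNIV" "\<psi> \<in> I \<rightarrow>\<^sub>E UNIV"
    and "\<And>i. i \<in> I \<Longrightarrow> \<psi> i = (INF f\<in>F. \<phi> f \<rhd> pairing C f i)"
    and "\<And>f. f \<in> F \<Longrightarrow> \<phi> f = (INF i\<in>I. pairing C f i \<lhd> \<psi> i)"
  shows "(\<phi>, \<psi>) \<in> pts (canext C F I)"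
  using assms unfolding canext_def space.simps mem_Collect_eq prod.case by blast

lemma le_fst_cut:
  assumes "\<kappa> \<in> pts (canext C F I)" "f \<in> F"
  shows "x \<le> fst \<kappa> f \<longleftrightarrow> (\<forall>i\<in>I. x * snd \<kappa> i \<le> pairing C f i)"
  by (simp only: cut_components(4)[OF assms] le_INF_iff lres_iff)

lemma le_snd_cut:
  assumes "\<kappa> \<in> pts (canext C F I)" "i \<in> I"
  shows "x \<le> snd \<kappa> i \<longleftrightarrow> (\<forall>f\<in>F. fst \<kappa> f * x \<le> pairing C f i)"
  by (simp only: cut_components(3)[OF assms] le_INF_iff rres_iff)

lemma le_canext_hom_fst:
  "x \<le> hom (canext C F I) \<kappa> \<kappa>' \<longleftrightarrow> (\<forall>f\<in>F. fst \<kappa> f * x \<le> fst \<kappa>' f)"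
  by (simp add: canext_def le_INF_iff rres_iff)

lemma le_canext_hom_snd:
  assumes "\<kappa> \<in> pts (canext C F I)" "\<kappa>' \<in> pts (canext C F I)"
  shows "x \<le> hom (canext C F I) \<kappa> \<kappa>' \<longleftrightarrow> (\<forall>i\<in>I. x * snd \<kappa>' i \<le> snd \<kappa> i)"
  by (simp add: canext_hom_snd[OF assms] le_INF_iff lres_iff)

lemma cut_eqI:
  assumes "\<kappa> \<in> pts (canext C F I)" "\<kappa>' \<in> pts (canext C F I)"
    and "\<And>f. f \<in> F \<Longrightarrow> fst \<kappa> f = fst \<kappa>' f" "\<And>i. i \<in> I \<Longrightarrow> snd \<kappa> i = snd \<kappa>' i"
  shows "\<kappa> = \<kappa>'"
proof (rule prod_eqI)
  show "fst \<kappa> = fst \<kappa>'"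
    using assms(1,2)[THEN cut_components(1)] assms(3) by (rule PiE_ext)
  show "snd \<kappa> = snd \<kappa>'"
    using assms(1,2)[THEN cut_components(2)] assms(4) by (rule PiE_ext)
qed

lemma cut_eqI_fst:
  assumes "\<kappa> \<in> pts (canext C F I)" "\<kappa>' \<in> pts (canext C F I)"
    and "\<And>f. f \<in> F \<Longrightarrow> fst \<kappa> f = fst \<kappa>' f"
  shows "\<kappa> = \<kappa>'"
  using assms(1,2)
proof (rule cut_eqI)
  show "snd \<kappa> i = snd \<kappa>' i" if "i \<in> I" for i
    by (rule eq_if_same_lower_bounds) (use assms that in \<open>simp add: le_snd_cut\<close>)
qed (rule assms(3))

lemma cut_eqI_snd:
  assumes "\<kappa> \<in> pts (canext C F I)" "\<kappa>' \<in> pts (canext C F I)"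
    and "\<And>i. i \<in> I \<Longrightarrow> snd \<kappa> i = snd \<kappa>' i"
  shows "\<kappa> = \<kappa>'"
  using assms(1,2)
proof (rule cut_eqI)
  show "fst \<kappa> f = fst \<kappa>' f" if "f \<in> F" for f
    by (rule eq_if_same_lower_bounds) (use assms that in \<open>simp add: le_fst_cut\<close>)
qed (rule assms(3))

lemma separated_canext: "separated (canext C F I)"
  unfolding separated_def le_canext_hom_fst
proof (intro conjI ballI impI)
  show "\<kappa> = \<kappa>'" if "\<kappa> \<in> pts (canext C F I)" "\<kappa>' \<in> pts (canext C F I)"
    and "\<forall>f\<in>F. fst \<kappa> f * 1 \<le> fst \<kappa>' f" "\<forall>f\<in>F. fst \<kappa>' f * 1 \<le> fst \<kappa> f" for \<kappa> \<kappa>'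
    using that(1,2)
  proof (rule cut_eqI_fst)
    show "fst \<kappa> f = fst \<kappa>' f" if "f \<in> F" for f
      using \<open>\<forall>f\<in>F. fst \<kappa> f * 1 \<le> fst \<kappa>' f\<close> \<open>\<forall>f\<in>F. fst \<kappa>' f * 1 \<le> fst \<kappa> f\<close> that
      by (simp add: order.antisym)
  qed
qed simp

text \<open>
  The two passages between \<open>F\<close>-weights and \<open>I\<close>-weights form a Galois connection, so one step from an
  arbitrary \<open>F\<close>-weight already lands in a second component of a cut, and dually for \<open>I\<close>-weights.
\<close>

lemma cut_from_fst:
  fixes C :: "('a, 'q::quantale) space"
  obtains \<kappa> where "\<kappa> \<in> pts (canext C F I)"
    and "\<And>i x. i \<in> I \<Longrightarrow> x \<le> snd \<kappa> i \<longleftrightarrow> (\<forall>f\<in>F. \<phi> f * x \<le> pairing C f i)"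
proof -
  define \<psi> where "\<psi> = (\<lambda>i\<in>I. INF f\<in>F. \<phi> f \<rhd> pairing C f i)"
  define \<phi>' where "\<phi>' = (\<lambda>f\<in>F. INF i\<in>I. pairing C f i \<lhd> \<psi> i)"
  have \<psi>: "x \<le> \<psi> i \<longleftrightarrow> (\<forall>f\<in>F. \<phi> f * x \<le> pairing C f i)" if "i \<in> I" for i x
    using that by (simp add: \<psi>_def le_INF_iff rres_iff)
  have \<phi>': "x \<le> \<phi>' f \<longleftrightarrow> (\<forall>i\<in>I. x * \<psi> i \<le> pairing C f i)" if "f \<in> F" for f x
    using that by (simp add: \<phi>'_def le_INF_iff lres_iff)
  have unit: "\<phi> f \<le> \<phi>' f" if "f \<in> F" for f
    using that \<phi>' \<psi> by blast
  have closed: "\<psi> i = (INF f\<in>F. \<phi>' f \<rhd> pairing C f i)" if i: "i \<in> I" for i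
  proof (rule eq_if_same_lower_bounds)
    fix x
    show "x \<le> \<psi> i \<longleftrightarrow> x \<le> (INF f\<in>F. \<phi>' f \<rhd> pairing C f i)"
      unfolding le_INF_iff rres_iff
    proof
      assume x: "x \<le> \<psi> i"
      show "\<forall>f\<in>F. \<phi>' f * x \<le> pairing C f i"
      proof
        fix f assume "f \<in> F"
        then have "\<phi>' f * \<psi> i \<le> pairing C f i" using i \<phi>' by blast
        with mult_left_mono_q[OF x] show "\<phi>' f * x \<le> pairing C f i" by (rule order.trans)
      qed
    next
      assume "\<forall>f\<in>F. \<phi>' f * x \<le> pairing C f i"
      then show "x \<le> \<psi> i"
        unfolding \<psi>[OF i] using unit by (meson order.trans mult_right_mono_q)
    qed
  qed
  have "(\<phi>', \<psi>) \<in> pts (canext C F I)"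
  proof (rule cutI[OF _ _ closed])
    show "\<phi>' \<in> F \<rightarrow>\<^sub>E UNIV" "\<psi> \<in> I \<rightarrow>\<^sub>E UNIV" by (simp_all add: \<phi>'_def \<psi>_def)
  qed (simp_all add: \<phi>'_def)
  with \<psi> show thesis by (auto intro: that)
qed

lemma cut_from_snd:
  fixes C :: "('a, 'q::quantale) space"
  obtains \<kappa> where "\<kappa> \<in> pts (canext C F I)"
    and "\<And>f x. f \<in> F \<Longrightarrow> x \<le> fst \<kappa> f \<longleftrightarrow> (\<forall>i\<in>I. x * \<psi> i \<le> pairing C f i)"
proof -
  define \<phi> where "\<phi> = (\<lambda>f\<in>F. INF i\<in>I. pairing C f i \<lhd> \<psi> i)"
  define \<psi>' where "\<psi>' = (\<lambda>i\<in>I. INF f\<in>F. \<phi> f \<rhd> pairing C f i)"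
  have \<phi>: "x \<le> \<phi> f \<longleftrightarrow> (\<forall>i\<in>I. x * \<psi> i \<le> pairing C f i)" if "f \<in> F" for f x
    using that by (simp add: \<phi>_def le_INF_iff lres_iff)
  have \<psi>': "x \<le> \<psi>' i \<longleftrightarrow> (\<forall>f\<in>F. \<phi> f * x \<le> pairing C f i)" if "i \<in> I" for i x
    using that by (simp add: \<psi>'_def le_INF_iff rres_iff)
  have unit: "\<psi> i \<le> \<psi>' i" if "i \<in> I" for i
    using that \<phi> \<psi>' by blast
  have closed: "\<phi> f = (INF i\<in>I. pairing C f i \<lhd> \<psi>' i)" if f: "f \<in> F" for f
  proof (rule eq_if_same_lower_bounds)
    fix x
    show "x \<le> \<phi> f \<longleftrightarrow> x \<le> (INF i\<in>I. pairing C f i \<lhd> \<psi>' i)"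
      unfolding le_INF_iff lres_iff
    proof
      assume x: "x \<le> \<phi> f"
      show "\<forall>i\<in>I. x * \<psi>' i \<le> pairing C f i"
      proof
        fix i assume "i \<in> I"
        then have "\<phi> f * \<psi>' i \<le> pairing C f i" using f \<psi>' by blast
        with mult_right_mono_q[OF x] show "x * \<psi>' i \<le> pairing C f i" by (rule order.trans)
      qed
    next
      assume "\<forall>i\<in>I. x * \<psi>' i \<le> pairing C f i"
      then show "x \<le> \<phi> f"
        unfolding \<phi>[OF f] using unit by (meson order.trans mult_left_mono_q)
    qed
  qed
  have "(\<phi>, \<psi>') \<in> pts (canext C F I)"
  proof (rule cutI[OF _ _ _ closed])
    show "\<phi> \<in> F \<rightarrow>\<^sub>E UNIV" "\<psi>' \<in> I \<rightarrow>\<^sub>E UNIV" by (simp_all add: \<phi>_def \<psi>'_def)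
  qed (simp_all add: \<psi>'_def)
  with \<phi> show thesis by (auto intro: that)
qed

section \<open>Weighted limits and colimits of cuts\<close>

text \<open>
  A hom into a cut \<open>b\<close> tests a weight against the first component of \<open>b\<close>, which is itself closed
  under the Galois connection. The colimit is therefore the cut generated by the pointwise weighted
  join of the first components.
\<close>

lemma canext_is_colim_wcolim:
  fixes C :: "('a, 'q::quantale) space"
  shows "is_colim (canext C F I) (discrete S) w H (wcolim (canext C F I) (discrete S) w H)"
proof -
  obtain \<kappa> where \<kappa>: "\<kappa> \<in> pts (canext C F I)"
    and snd_\<kappa>: "\<And>i x. i \<in> I \<Longrightarrow>
      x \<le> snd \<kappa> i \<longleftrightarrow> (\<forall>f\<in>F. (SUP s\<in>S. fst (H s) f * w s) * x \<le> pairing C f i)"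
    by (rule cut_from_fst[of C F I "\<lambda>f. SUP s\<in>S. fst (H s) f * w s"]) blast
  have "hom (canext C F I) \<kappa> b = (INF s\<in>S. w s \<rhd> hom (canext C F I) (H s) b)"
    if b: "b \<in> pts (canext C F I)" for b
  proof (rule eq_if_same_lower_bounds)
    fix x
    have "x \<le> hom (canext C F I) \<kappa> b \<longleftrightarrow>
      (\<forall>i\<in>I. \<forall>f\<in>F. \<forall>s\<in>S. fst (H s) f * w s * (x * snd b i) \<le> pairing C f i)"
      using \<kappa> b by (simp add: le_canext_hom_snd snd_\<kappa> SUP_mult SUP_le_iff)
    also have "\<dots> \<longleftrightarrow>
      (\<forall>s\<in>S. \<forall>f\<in>F. \<forall>i\<in>I. fst (H s) f * (w s * x) * snd b i \<le> pairing C f i)"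
      unfolding mult.assoc by blast
    also have "\<dots> \<longleftrightarrow> (\<forall>s\<in>S. \<forall>f\<in>F. fst (H s) f * (w s * x) \<le> fst b f)"
      by (intro ball_cong refl) (simp only: le_fst_cut[OF b])
    also have "\<dots> \<longleftrightarrow> x \<le> (INF s\<in>S. w s \<rhd> hom (canext C F I) (H s) b)"
      by (simp add: le_INF_iff rres_iff le_canext_hom_fst)
    finally show "x \<le> hom (canext C F I) \<kappa> b \<longleftrightarrow> \<dots>" .
  qed
  with \<kappa> have colim: "is_colim (canext C F I) (discrete S) w H \<kappa>"
    by (simp add: is_colim_def discrete_def)
  then show ?thesis unfolding wcolim_eq[OF separated_canext colim] .
qed

text \<open>
  Dually, the limit is the cut generated by the pointwise weighted join of the second components.
  The values of \<open>H\<close> must be cuts here, because a hom is computed from second components only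
  between cuts.
\<close>

lemma canext_is_lim_wlim:
  fixes C :: "('a, 'q::quantale) space"
  assumes H: "H \<in> S \<rightarrow> pts (canext C F I)"
  shows "is_lim (canext C F I) (discrete S) w H (wlim (canext C F I) (discrete S) w H)"
proof -
  obtain \<kappa> where \<kappa>: "\<kappa> \<in> pts (canext C F I)"
    and fst_\<kappa>: "\<And>f x. f \<in> F \<Longrightarrow>
      x \<le> fst \<kappa> f \<longleftrightarrow> (\<forall>i\<in>I. x * (SUP s\<in>S. w s * snd (H s) i) \<le> pairing C f i)"
    by (rule cut_from_snd[of C F I "\<lambda>i. SUP s\<in>S. w s * snd (H s) i"]) blast
  have "hom (canext C F I) b \<kappa> = (INF s\<in>S. hom (canext C F I) b (H s) \<lhd> w s)"
    if b: "b \<in> pts (canext C F I)" for b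
  proof (rule eq_if_same_lower_bounds)
    fix x
    have "x \<le> hom (canext C F I) b \<kappa> \<longleftrightarrow>
      (\<forall>f\<in>F. \<forall>i\<in>I. \<forall>s\<in>S. fst b f * x * (w s * snd (H s) i) \<le> pairing C f i)"
      by (simp add: le_canext_hom_fst fst_\<kappa> mult_SUP SUP_le_iff)
    also have "\<dots> \<longleftrightarrow>
      (\<forall>s\<in>S. \<forall>i\<in>I. \<forall>f\<in>F. fst b f * (x * w s * snd (H s) i) \<le> pairing C f i)"
      unfolding mult.assoc by blast
    also have "\<dots> \<longleftrightarrow> (\<forall>s\<in>S. \<forall>i\<in>I. x * w s * snd (H s) i \<le> snd b i)"
      by (intro ball_cong refl) (simp only: le_snd_cut[OF b])
    also have "\<dots> \<longleftrightarrow> (\<forall>s\<in>S. x * w s \<le> hom (canext C F I) b (H s))"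
      by (intro ball_cong refl) (simp only: le_canext_hom_snd[OF b funcset_mem[OF H]])
    also have "\<dots> \<longleftrightarrow> x \<le> (INF s\<in>S. hom (canext C F I) b (H s) \<lhd> w s)"
      by (simp add: le_INF_iff lres_iff)
    finally show "x \<le> hom (canext C F I) b \<kappa> \<longleftrightarrow> \<dots>" .
  qed
  with \<kappa> have lim: "is_lim (canext C F I) (discrete S) w H \<kappa>"
    by (simp add: is_lim_def discrete_def)
  then show ?thesis unfolding wlim_eq[OF separated_canext lim] .
qed

section \<open>The embeddings of \<open>F\<close> and \<open>I\<close>\<close>

text \<open>
  For \<open>f \<in> F\<close> the weight \<open>pairing C f\<close> on \<open>I\<close> is already closed under the Galois connection, so the
  cut that it generates has it as its second component; dually for \<open>i \<in> I\<close>.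
\<close>

lemma bar_up_cut:
  fixes C :: "('a, 'q::quantale) space"
  assumes f: "f \<in> F"
  shows "bar_up C F I f \<in> pts (canext C F I) \<and> (\<forall>i\<in>I. snd (bar_up C F I f) i = pairing C f i)"
proof -
  obtain \<kappa> where \<kappa>: "\<kappa> \<in> pts (canext C F I)"
    and fst_\<kappa>: "\<And>g x. g \<in> F \<Longrightarrow> x \<le> fst \<kappa> g \<longleftrightarrow> (\<forall>i\<in>I. x * pairing C f i \<le> pairing C g i)"
    by (rule cut_from_snd[of C F I "pairing C f"]) blast
  have "snd \<kappa> i = pairing C f i" if i: "i \<in> I" for i
  proof (rule order.antisym)
    \<comment> \<open>Testing \<open>f\<close> against itself is where membership of \<open>f\<close> in \<open>F\<close> enters.\<close>
    have "1 \<le> fst \<kappa> f" using fst_\<kappa>[OF f] by simp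
    then have "1 * snd \<kappa> i \<le> fst \<kappa> f * snd \<kappa> i" by (rule mult_right_mono_q)
    also have "\<dots> \<le> pairing C f i" using le_snd_cut[OF \<kappa> i] f by blast
    finally show "snd \<kappa> i \<le> pairing C f i" by simp
    show "pairing C f i \<le> snd \<kappa> i"
      using le_snd_cut[OF \<kappa> i] fst_\<kappa> i by blast
  qed
  with \<kappa> have "\<exists>!\<kappa>. \<kappa> \<in> pts (canext C F I) \<and> (\<forall>i\<in>I. snd \<kappa> i = pairing C f i)"
  proof (intro ex1I[of _ \<kappa>] conjI ballI)
    show "\<kappa>' = \<kappa>" if "\<kappa>' \<in> pts (canext C F I) \<and> (\<forall>i\<in>I. snd \<kappa>' i = pairing C f i)" for \<kappa>'
      by (rule cut_eqI_snd[of _ C F I])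
        (use \<kappa> that \<open>\<And>i. i \<in> I \<Longrightarrow> snd \<kappa> i = pairing C f i\<close> in simp_all)
  qed
  then show ?thesis unfolding bar_up_def by (rule theI')
qed

lemma bar_down_cut:
  fixes C :: "('a, 'q::quantale) space"
  assumes i: "i \<in> I"
  shows "bar_down C F I i \<in> pts (canext C F I) \<and>
    (\<forall>f\<in>F. fst (bar_down C F I i) f = pairing C f i)"
proof -
  obtain \<kappa> where \<kappa>: "\<kappa> \<in> pts (canext C F I)"
    and snd_\<kappa>: "\<And>j x. j \<in> I \<Longrightarrow> x \<le> snd \<kappa> j \<longleftrightarrow> (\<forall>f\<in>F. pairing C f i * x \<le> pairing C f j)"
    by (rule cut_from_fst[of C F I "\<lambda>f. pairing C f i"]) blast
  have "fst \<kappa> f = pairing C f i" if f: "f \<in> F" for f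
  proof (rule order.antisym)
    have "1 \<le> snd \<kappa> i" using snd_\<kappa>[OF i] by simp
    then have "fst \<kappa> f * 1 \<le> fst \<kappa> f * snd \<kappa> i" by (rule mult_left_mono_q)
    also have "\<dots> \<le> pairing C f i" using le_fst_cut[OF \<kappa> f] i by blast
    finally show "fst \<kappa> f \<le> pairing C f i" by simp
    show "pairing C f i \<le> fst \<kappa> f"
      using le_fst_cut[OF \<kappa> f] snd_\<kappa> f by blast
  qed
  with \<kappa> have "\<exists>!\<kappa>. \<kappa> \<in> pts (canext C F I) \<and> (\<forall>f\<in>F. fst \<kappa> f = pairing C f i)"
  proof (intro ex1I[of _ \<kappa>] conjI ballI)
    show "\<kappa>' = \<kappa>" if "\<kappa>' \<in> pts (canext C F I) \<and> (\<forall>f\<in>F. fst \<kappa>' f = pairing C f i)" for \<kappa>'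
      by (rule cut_eqI_fst[of _ C F I])
        (use \<kappa> that \<open>\<And>f. f \<in> F \<Longrightarrow> fst \<kappa> f = pairing C f i\<close> in simp_all)
  qed
  then show ?thesis unfolding bar_down_def by (rule theI')
qed

text \<open>
  The next two lemmas are the Yoneda lemma for cuts: the defining equations of a cut say exactly that
  its components are represented by the embedded copies of \<open>F\<close> and \<open>I\<close>.
\<close>

lemma bar_up_hom:
  assumes "\<kappa> \<in> pts (canext C F I)" "f \<in> F"
  shows "hom (canext C F I) (bar_up C F I f) \<kappa> = fst \<kappa> f"
  by (rule eq_if_same_lower_bounds)
    (use assms bar_up_cut[OF assms(2), of C I] in \<open>simp add: le_canext_hom_snd le_fst_cut\<close>)

lemma hom_bar_down:
  assumes "\<kappa> \<in> pts (canext C F I)" "i \<in> I"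
  shows "hom (canext C F I) \<kappa> (bar_down C F I i) = snd \<kappa> i"
  by (rule eq_if_same_lower_bounds)
    (use assms bar_down_cut[OF assms(2), of C F] in \<open>simp add: le_canext_hom_fst le_snd_cut\<close>)

section \<open>Adjunctions from adjoint maps of polarities\<close>

text \<open>
  The adjointness of \<open>P\<close> and \<open>Q\<close> enters once, when \<open>pairing B (P f) i\<close> is replaced by
  \<open>pairing A f (Q i)\<close>. Before that step the universal property of the colimit is unwound, after it
  that of the limit.
\<close>

lemma polarity_adjunction:
  fixes A :: "('a, 'q::quantale) space" and B :: "('b, 'q) space"
  assumes P: "\<And>f. f \<in> FA \<Longrightarrow> P f \<in> FB" and Q: "\<And>i. i \<in> IB \<Longrightarrow> Q i \<in> IA"
    and adj: "\<And>f i. f \<in> FA \<Longrightarrow> i \<in> IB \<Longrightarrow> pairing B (P f) i = pairing A f (Q i)"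
  shows "adjunction (canext A FA IA) (canext B FB IB)
    (\<lambda>\<kappa>. wcolim (canext B FB IB) (discrete FA) (fst \<kappa>) (\<lambda>f. bar_up B FB IB (P f)))
    (\<lambda>\<kappa>. wlim (canext A FA IA) (discrete IB) (snd \<kappa>) (\<lambda>i. bar_down A FA IA (Q i)))"
    (is "adjunction ?A ?B ?L ?R")
proof -
  have colim: "is_colim ?B (discrete FA) (fst \<kappa>) (\<lambda>f. bar_up B FB IB (P f)) (?L \<kappa>)" for \<kappa>
    by (rule canext_is_colim_wcolim)
  have lim: "is_lim ?A (discrete IB) (snd \<kappa>) (\<lambda>i. bar_down A FA IA (Q i)) (?R \<kappa>)" for \<kappa>
    using bar_down_cut Q by (intro canext_is_lim_wlim) blast
  have "hom ?B (?L \<kappa>) \<mu> = hom ?A \<kappa> (?R \<mu>)" if \<kappa>: "\<kappa> \<in> pts ?A" and \<mu>: "\<mu> \<in> pts ?B" for \<kappa> \<mu>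
  proof (rule eq_if_same_lower_bounds)
    fix x
    have "hom ?B (?L \<kappa>) \<mu> = (INF f\<in>FA. fst \<kappa> f \<rhd> fst \<mu> (P f))"
      using colim[of \<kappa>] \<mu> P by (simp add: is_colim_def discrete_def bar_up_hom)
    then have "x \<le> hom ?B (?L \<kappa>) \<mu> \<longleftrightarrow>
        (\<forall>f\<in>FA. \<forall>i\<in>IB. fst \<kappa> f * x * snd \<mu> i \<le> pairing B (P f) i)"
      using \<mu> P by (simp add: le_INF_iff rres_iff le_fst_cut)
    also have "\<dots> \<longleftrightarrow> (\<forall>i\<in>IB. \<forall>f\<in>FA. fst \<kappa> f * (x * snd \<mu> i) \<le> pairing A f (Q i))"
      using adj by (auto simp: mult.assoc)
    also have "\<dots> \<longleftrightarrow> x \<le> (INF i\<in>IB. snd \<kappa> (Q i) \<lhd> snd \<mu> i)"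
      using \<kappa> Q by (simp add: le_INF_iff lres_iff le_snd_cut)
    also have "(INF i\<in>IB. snd \<kappa> (Q i) \<lhd> snd \<mu> i) = hom ?A \<kappa> (?R \<mu>)"
      using lim[of \<mu>] \<kappa> Q by (simp add: is_lim_def discrete_def hom_bar_down)
    finally show "x \<le> hom ?B (?L \<kappa>) \<mu> \<longleftrightarrow> x \<le> hom ?A \<kappa> (?R \<mu>)" .
  qed
  then show ?thesis
    using colim lim by (auto simp: adjunction_def is_colim_def is_lim_def)
qed

section \<open>Pushforwards\<close>

lemma push_down_eq:
  fixes C :: "('a, 'q::quantale) space" and D :: "('b, 'q) space"
  assumes D: "is_space D" and G: "G \<in> pts C \<rightarrow> pts D"
  shows "push_down C D G i = (\<lambda>d\<in>pts D. SUP c\<in>pts C. hom D d (G c) * i c)" (is "_ = ?k")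
proof -
  have "?k \<in> pts (\<D> D)"
  proof -
    have "hom D d' d * (hom D d (G c) * i c) \<le> hom D d' (G c) * i c"
      if "d \<in> pts D" "d' \<in> pts D" "c \<in> pts C" for d d' c
      using D G that unfolding mult.assoc[symmetric] is_space_def
      by (intro mult_right_mono_q) blast
    then show ?thesis by (auto simp: downsets_def mult_SUP intro!: SUP_subset_mono)
  qed
  moreover have "hom (\<D> D) ?k b = (INF c\<in>pts C. i c \<rhd> hom (\<D> D) (down_rep D (G c)) b)" for b
    by (rule eq_if_same_lower_bounds)
      (auto simp: le_downsets_hom le_INF_iff rres_iff SUP_mult SUP_le_iff down_rep_def mult.assoc)
  ultimately have "is_colim (\<D> D) C i (\<lambda>c. down_rep D (G c)) ?k"
    by (simp add: is_colim_def)
  then show ?thesis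
    unfolding push_down_def by (rule wcolim_eq[OF separated_downsets])
qed

lemma push_up_eq:
  fixes C :: "('a, 'q::quantale) space" and D :: "('b, 'q) space"
  assumes D: "is_space D" and G: "G \<in> pts C \<rightarrow> pts D"
  shows "push_up C D G f = (\<lambda>d\<in>pts D. SUP c\<in>pts C. f c * hom D (G c) d)" (is "_ = ?k")
proof -
  have "?k \<in> pts (\<U> D)"
  proof -
    have "f c * hom D (G c) d * hom D d d' \<le> f c * hom D (G c) d'"
      if "d \<in> pts D" "d' \<in> pts D" "c \<in> pts C" for d d' c
      using D G that unfolding mult.assoc is_space_def
      by (intro mult_left_mono_q) blast
    then show ?thesis by (auto simp: upsets_def SUP_mult intro!: SUP_subset_mono)
  qed
  moreover have "hom (\<U> D) b ?k = (INF c\<in>pts C. hom (\<U> D) b (up_rep D (G c)) \<lhd> f c)" for b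
    by (rule eq_if_same_lower_bounds)
      (auto simp: le_upsets_hom le_INF_iff lres_iff mult_SUP SUP_le_iff up_rep_def mult.assoc)
  ultimately have "is_lim (\<U> D) C f (\<lambda>c. up_rep D (G c)) ?k"
    by (simp add: is_lim_def)
  then show ?thesis
    unfolding push_up_def by (rule wlim_eq[OF separated_upsets])
qed

text \<open>
  Exchanging joins leaves the join over \<open>d\<close> of \<open>f d * hom D d (G c)\<close>. Since \<open>f\<close> is an upset, this
  join is at most \<open>f (G c)\<close>, and the term at \<open>d = G c\<close> attains that bound because \<open>1 \<le> hom D d d\<close>.
\<close>

lemma pairing_push_down:
  fixes C :: "('a, 'q::quantale) space" and D :: "('b, 'q) space"
  assumes D: "is_space D" and G: "G \<in> pts C \<rightarrow> pts D" and f: "f \<in> pts (\<U> D)"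
  shows "pairing C (pull C G f) i = pairing D f (push_down C D G i)"
proof -
  have coyoneda: "(SUP d\<in>pts D. f d * hom D d y) = f y" if y: "y \<in> pts D" for y
  proof (rule order.antisym)
    show "(SUP d\<in>pts D. f d * hom D d y) \<le> f y"
      using f y by (auto simp: upsets_def intro: SUP_least)
    have "f y * 1 \<le> f y * hom D y y"
      using D y by (intro mult_left_mono_q) (simp add: is_space_def)
    also have "\<dots> \<le> (SUP d\<in>pts D. f d * hom D d y)" using y by (rule SUP_upper)
    finally show "f y \<le> (SUP d\<in>pts D. f d * hom D d y)" by simp
  qed
  have "pairing D f (push_down C D G i)
      = (SUP d\<in>pts D. SUP c\<in>pts C. f d * hom D d (G c) * i c)"
    by (simp add: pairing_def push_down_eq[OF D G] mult_SUP mult.assoc)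
  also have "\<dots> = (SUP c\<in>pts C. (SUP d\<in>pts D. f d * hom D d (G c)) * i c)"
    unfolding SUP_mult by (rule SUP_commute)
  also have "\<dots> = pairing C (pull C G f) i"
    unfolding pairing_def
    by (intro SUP_cong) (simp_all add: pull_def coyoneda funcset_mem[OF G])
  finally show ?thesis by simp
qed

text \<open>
  The same argument with the sides of the multiplication exchanged and a downset \<open>i\<close> in place of \<open>f\<close>.
\<close>

lemma pairing_push_up:
  fixes C :: "('a, 'q::quantale) space" and D :: "('b, 'q) space"
  assumes D: "is_space D" and G: "G \<in> pts C \<rightarrow> pts D" and i: "i \<in> pts (\<D> D)"
  shows "pairing D (push_up C D G f) i = pairing C f (pull C G i)"
proof -
  have coyoneda: "(SUP d\<in>pts D. hom D y d * i d) = i y" if y: "y \<in> pts D" for y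
  proof (rule order.antisym)
    show "(SUP d\<in>pts D. hom D y d * i d) \<le> i y"
      using i y by (auto simp: downsets_def intro: SUP_least)
    have "1 * i y \<le> hom D y y * i y"
      using D y by (intro mult_right_mono_q) (simp add: is_space_def)
    also have "\<dots> \<le> (SUP d\<in>pts D. hom D y d * i d)" using y by (rule SUP_upper)
    finally show "i y \<le> (SUP d\<in>pts D. hom D y d * i d)" by simp
  qed
  have "pairing D (push_up C D G f) i
      = (SUP d\<in>pts D. SUP c\<in>pts C. f c * (hom D (G c) d * i d))"
    by (simp add: pairing_def push_up_eq[OF D G] SUP_mult mult.assoc)
  also have "\<dots> = (SUP c\<in>pts C. f c * (SUP d\<in>pts D. hom D (G c) d * i d))"
    unfolding mult_SUP by (rule SUP_commute)
  also have "\<dots> = pairing C f (pull C G i)"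
    unfolding pairing_def
    by (intro SUP_cong) (simp_all add: pull_def coyoneda funcset_mem[OF G])
  finally show ?thesis .
qed

section \<open>The adjunctions induced by a functor\<close>

theorem theorem4p24:
  fixes C :: "('a, 'q::quantale) space" and D :: "('b, 'q) space"
    and FC IC :: "('a \<Rightarrow> 'q) set" and FD ID :: "('b \<Rightarrow> 'q) set"
    and G :: "'a \<Rightarrow> 'b"
  assumes "is_space C" and "is_space D" and "is_functor C D G"
    and "ext_data C FC IC" and "ext_data D FD ID"
  shows "((\<forall>f\<in>FD. pull C G f \<in> FC) \<and> (\<forall>i\<in>IC. push_down C D G i \<in> ID) \<longrightarrow>
            adjunction (canext D FD ID) (canext C FC IC)
              (ext_l C FC IC FD G) (ext_pi C IC D FD ID G)) \<and>
         ((\<forall>f\<in>FC. push_up C D G f \<in> FD) \<and> (\<forall>i\<in>ID. pull C G i \<in> IC) \<longrightarrow>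
            adjunction (canext C FC IC) (canext D FD ID)
              (ext_sigma C FC D FD ID G) (ext_r C FC IC ID G))"
proof (intro conjI impI)
  have G: "G \<in> pts C \<rightarrow> pts D" using assms(3) by (simp add: is_functor_def)
  have FD: "FD \<subseteq> pts (\<U> D)" and ID: "ID \<subseteq> pts (\<D> D)"
    using assms(5) by (simp_all add: ext_data_def)
  {
    assume "(\<forall>f\<in>FD. pull C G f \<in> FC) \<and> (\<forall>i\<in>IC. push_down C D G i \<in> ID)"
    then show "adjunction (canext D FD ID) (canext C FC IC)
        (ext_l C FC IC FD G) (ext_pi C IC D FD ID G)"
      unfolding ext_l_def[abs_def] ext_pi_def[abs_def]
      using pairing_push_down[OF assms(2) G] FD by (intro polarity_adjunction) auto
  next
    assume "(\<forall>f\<in>FC. push_up C D G f \<in> FD) \<and> (\<forall>i\<in>ID. pull C G i \<in> IC)"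
    then show "adjunction (canext C FC IC) (canext D FD ID)
        (ext_sigma C FC D FD ID G) (ext_r C FC IC ID G)"
      unfolding ext_sigma_def[abs_def] ext_r_def[abs_def]
      using pairing_push_up[OF assms(2) G] ID by (intro polarity_adjunction) auto
  }
qed

end
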